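(* Let $H\subset\mathcal{C}(\mathbb{R}_+,\mathbb{R})$ be a set of continuous functions on $\mathbb{R}_+=[0,\infty[$ which is equicontinuous after the humps. If $H(t)=\{f(t):f\in H\}$ is relatively compact in $\mathbb{R}$ for each $t\in\mathbb{R}_+$, then $H$ is relatively compact in the space $X$ of all functions from $\mathbb{R}_+$ to $\mathbb{R}$ equipped with the sticking topology.
   Context: For a countable (possibly finite) set $C\subset X=\mathbb{R}^{\mathbb{R}_+}$ and $s,t\in\mathbb{R}_+$ put $$\rho_C(s,t)=\inf_{\mathcal{J}\subset C,\ \mathcal{J}\text{ finite}}\ \sup_{f\in C\setminus\mathcal{J}}|f(s)-f(t)|,$$ with the convention $\sup\emptyset=0$, and for any $A\subset X$ put $$e_A(s,t)=\sup_{C\subset A,\ C\text{ countable}}\rho_C(s,t).$$ A set $H\subset X$ is "equicontinuous after the humps" if for every $t\in\mathbb{R}_+$ there exists $B\subset H$, equicontinuous at $t$, such that $\lim_{s\to t}e_{H\setminus B}(s,t)=0$. The sticking topology on $X$: for $f\in X$, $\varepsilon>0$ and $t_1,\dots,t_k\in\mathbb{R}_+$, put $$E^\varepsilon_{t_1,\ldots,t_k}(f)=\{g\in X : \exists \eta>0,\ \forall t\in\mathbb{R}_+\cap\bigcup_{i=1}^k]t_i-\eta,t_i+\eta[,\ |f(t)-g(t)|<\varepsilon\};$$ a subset $U\subset X$ is open iff for each $f\in U$ it contains some $E^\varepsilon_{t_1,\ldots,t_k}(f)$. A subset is relatively compact if its closure is compact. *)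

theory Defs
  imports "HOL-Analysis.Analysis"
begin

text \<open>A function on \<open>\<real>\<^sub>+\<close> is represented by a function \<open>real \<Rightarrow> real\<close> taking the value
  \<open>undefined\<close> outside \<open>{0..}\<close>, so that equality is equality on \<open>\<real>\<^sub>+\<close>.\<close>

definition funs_Rplus :: "(real \<Rightarrow> real) set" where
  "funs_Rplus = {0..} \<rightarrow>\<^sub>E UNIV"

definition cont_funs_Rplus :: "(real \<Rightarrow> real) set" where
  "cont_funs_Rplus = {f \<in> funs_Rplus. continuous_on {0..} f}"

text \<open>The suprema are taken in \<^typ>\<open>ennreal\<close>: they may be infinite, and there the supremum
  of the empty set is \<open>0\<close>.\<close>

definition rho :: "(real \<Rightarrow> real) set \<Rightarrow> real \<Rightarrow> real \<Rightarrow> ennreal" where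
  "rho C s t = (INF J \<in> {J. J \<subseteq> C \<and> finite J}. SUP f \<in> C - J. ennreal \<bar>f s - f t\<bar>)"

definition hump_excess :: "(real \<Rightarrow> real) set \<Rightarrow> real \<Rightarrow> real \<Rightarrow> ennreal" where
  "hump_excess A s t = (SUP C \<in> {C. C \<subseteq> A \<and> countable C}. rho C s t)"

definition equicontinuous_at :: "(real \<Rightarrow> real) set \<Rightarrow> real \<Rightarrow> bool" where
  "equicontinuous_at B t \<longleftrightarrow>
     (\<forall>\<epsilon>>0. \<exists>\<delta>>0. \<forall>s\<in>{0..}. \<bar>s - t\<bar> < \<delta> \<longrightarrow> (\<forall>f\<in>B. \<bar>f s - f t\<bar> < \<epsilon>))"

definition equicontinuous_after_humps :: "(real \<Rightarrow> real) set \<Rightarrow> bool" where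
  "equicontinuous_after_humps H \<longleftrightarrow>
     (\<forall>t\<in>{0..}. \<exists>B\<subseteq>H. equicontinuous_at B t \<and>
        ((\<lambda>s. hump_excess (H - B) s t) \<longlongrightarrow> 0) (at t within {0..}))"

definition sticking_nbhd :: "real \<Rightarrow> real set \<Rightarrow> (real \<Rightarrow> real) \<Rightarrow> (real \<Rightarrow> real) set" where
  "sticking_nbhd \<epsilon> T f = {g \<in> funs_Rplus. \<exists>\<eta>>0.
     \<forall>t \<in> {0..} \<inter> (\<Union>\<tau>\<in>T. {\<tau> - \<eta> <..< \<tau> + \<eta>}). \<bar>f t - g t\<bar> < \<epsilon>}"

definition sticking_open :: "(real \<Rightarrow> real) set \<Rightarrow> bool" where
  "sticking_open U \<longleftrightarrow> U \<subseteq> funs_Rplus \<and>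
     (\<forall>f\<in>U. \<exists>\<epsilon>>0. \<exists>T. finite T \<and> T \<noteq> {} \<and> T \<subseteq> {0..} \<and> sticking_nbhd \<epsilon> T f \<subseteq> U)"

definition sticking_topology :: "(real \<Rightarrow> real) topology" where
  "sticking_topology = topology sticking_open"

definition relatively_compactin :: "'a topology \<Rightarrow> 'a set \<Rightarrow> bool" where
  "relatively_compactin X S \<longleftrightarrow> S \<subseteq> topspace X \<and> compactin X (X closure_of S)"

lemma sticking_nbhd_mono:
  assumes "\<epsilon> \<le> \<epsilon>'" "T' \<subseteq> T"
  shows "sticking_nbhd \<epsilon> T f \<subseteq> sticking_nbhd \<epsilon>' T' f"
proof
  fix g assume "g \<in> sticking_nbhd \<epsilon> T f"
  then obtain \<eta> where g: "g \<in> funs_Rplus" and "\<eta> > 0"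
    and \<eta>: "\<forall>t \<in> {0..} \<inter> (\<Union>\<tau>\<in>T. {\<tau> - \<eta> <..< \<tau> + \<eta>}). \<bar>f t - g t\<bar> < \<epsilon>"
    unfolding sticking_nbhd_def by blast
  have "\<forall>t \<in> {0..} \<inter> (\<Union>\<tau>\<in>T'. {\<tau> - \<eta> <..< \<tau> + \<eta>}). \<bar>f t - g t\<bar> < \<epsilon>'"
  proof
    fix t assume "t \<in> {0..} \<inter> (\<Union>\<tau>\<in>T'. {\<tau> - \<eta> <..< \<tau> + \<eta>})"
    with assms(2) have "t \<in> {0..} \<inter> (\<Union>\<tau>\<in>T. {\<tau> - \<eta> <..< \<tau> + \<eta>})" by blast
    with \<eta> have "\<bar>f t - g t\<bar> < \<epsilon>" by blast
    with assms(1) show "\<bar>f t - g t\<bar> < \<epsilon>'" by simp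
  qed
  with g \<open>\<eta> > 0\<close> show "g \<in> sticking_nbhd \<epsilon>' T' f"
    unfolding sticking_nbhd_def by blast
qed

lemma istopology_sticking_open: "istopology sticking_open"
  unfolding istopology_def
proof (intro conjI allI impI)
  fix U V assume U: "sticking_open U" and V: "sticking_open V"
  show "sticking_open (U \<inter> V)"
    unfolding sticking_open_def
  proof (intro conjI ballI)
    show "U \<inter> V \<subseteq> funs_Rplus"
      using U by (auto simp: sticking_open_def)
    fix f assume "f \<in> U \<inter> V"
    with U V obtain a S b T
      where a: "a > 0" "finite S" "S \<noteq> {}" "S \<subseteq> {0..}" "sticking_nbhd a S f \<subseteq> U"
        and b: "b > 0" "finite T" "T \<noteq> {}" "T \<subseteq> {0..}" "sticking_nbhd b T f \<subseteq> V"
      unfolding sticking_open_def by (metis IntE)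
    have "sticking_nbhd (min a b) (S \<union> T) f \<subseteq> U \<inter> V"
      using sticking_nbhd_mono[of "min a b" a S "S \<union> T" f]
        sticking_nbhd_mono[of "min a b" b T "S \<union> T" f] a(5) b(5) by auto
    then show "\<exists>\<epsilon>>0. \<exists>T. finite T \<and> T \<noteq> {} \<and> T \<subseteq> {0..} \<and> sticking_nbhd \<epsilon> T f \<subseteq> U \<inter> V"
      using a b by (intro exI[of _ "min a b"] conjI exI[of _ "S \<union> T"]) auto
  qed
next
  fix \<K> assume K: "\<forall>K\<in>\<K>. sticking_open K"
  show "sticking_open (\<Union>\<K>)"
    unfolding sticking_open_def
  proof (intro conjI ballI)
    show "\<Union>\<K> \<subseteq> funs_Rplus"
      using K by (auto simp: sticking_open_def)
    fix f assume "f \<in> \<Union>\<K>"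
    then obtain K where "K \<in> \<K>" "f \<in> K" by blast
    with K obtain a S where "a > 0" "finite S" "S \<noteq> {}" "S \<subseteq> {0..}" "sticking_nbhd a S f \<subseteq> K"
      unfolding sticking_open_def by metis
    with \<open>K \<in> \<K>\<close> show "\<exists>\<epsilon>>0. \<exists>T. finite T \<and> T \<noteq> {} \<and> T \<subseteq> {0..} \<and> sticking_nbhd \<epsilon> T f \<subseteq> \<Union>\<K>"
      by (meson Sup_upper subset_trans)
  qed
qed

lemma openin_sticking_topology: "openin sticking_topology U \<longleftrightarrow> sticking_open U"
  by (simp add: sticking_topology_def istopology_sticking_open topology_inverse')

lemma topspace_sticking_topology: "topspace sticking_topology = funs_Rplus"
proof -
  have "sticking_open funs_Rplus"
    unfolding sticking_open_def
  proof (intro conjI ballI)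
    fix f assume "f \<in> funs_Rplus"
    show "\<exists>\<epsilon>>0. \<exists>T. finite T \<and> T \<noteq> {} \<and> T \<subseteq> {0..} \<and> sticking_nbhd \<epsilon> T f \<subseteq> funs_Rplus"
      by (intro exI[of _ 1] conjI exI[of _ "{0}"]) (auto simp: sticking_nbhd_def)
  qed simp
  moreover have "U \<subseteq> funs_Rplus" if "sticking_open U" for U
    using that by (simp add: sticking_open_def)
  ultimately show ?thesis
    by (metis openin_sticking_topology openin_subset openin_topspace subset_antisym)
qed

end

theory Submission
  imports Defs
begin

text \<open>Near a point \<open>t\<close> where both functions are continuous, \<open>\<bar>f - g\<bar>\<close> is governed by
  \<open>\<bar>f t - g t\<bar>\<close>; so on continuous functions the sticking topology is the topology of pointwise
  convergence.  The pointwise closure of \<open>H\<close> is compact by Tychonoff, and it remains to see that it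
  consists of functions continuous at each \<open>t\<close>.  A limit of \<open>B\<close> is continuous at \<open>t\<close> by
  equicontinuity.  A limit \<open>f\<close> of \<open>A = H - B\<close> that is not in \<open>A\<close> is approximated at \<open>s\<close> and \<open>t\<close> by
  infinitely many members of \<open>A\<close>, so deleting finitely many humps does not matter and
  \<open>\<bar>f s - f t\<bar> \<le> hump_excess A s t\<close>.\<close>

abbreviation pointwise_topology :: "(real \<Rightarrow> real) topology" where
  "pointwise_topology \<equiv> product_topology (\<lambda>_. euclidean) {0..}"

lemma topspace_pointwise_topology: "topspace pointwise_topology = funs_Rplus"
  by (simp add: funs_Rplus_def)

lemma openin_pointwise_nbhd:
  assumes "finite T"
  shows "openin pointwise_topology {g \<in> funs_Rplus. \<forall>t\<in>T \<inter> {0..}. \<bar>g t - f t\<bar> < \<epsilon>}"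
proof -
  \<comment> \<open>Off \<open>T\<close> the factor is the whole line, so only finitely many factors
    are proper, as a basic open set of the product requires.\<close>
  let ?B = "\<lambda>t. if t \<in> T then ball (f t) \<epsilon> else UNIV"
  have "{g \<in> funs_Rplus. \<forall>t\<in>T \<inter> {0..}. \<bar>g t - f t\<bar> < \<epsilon>} = PiE {0..} ?B"
    by (auto simp: funs_Rplus_def PiE_def Pi_def dist_real_def abs_minus_commute)
  moreover have "finite {t. ?B t \<noteq> topspace euclidean}"
    by (rule finite_subset[OF _ assms]) auto
  then have "openin pointwise_topology (PiE {0..} ?B)"
    by (intro product_topology_basis) auto
  ultimately show ?thesis by simp
qed

lemma pointwise_closure_approx:
  assumes "f \<in> pointwise_topology closure_of A" "finite T" "T \<subseteq> {0..}" "\<epsilon> > 0"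
  shows "\<exists>g\<in>A. \<forall>t\<in>T. \<bar>g t - f t\<bar> < \<epsilon>"
proof -
  have "f \<in> funs_Rplus"
    using assms(1) by (simp add: in_closure_of funs_Rplus_def)
  then have "f \<in> {g \<in> funs_Rplus. \<forall>t\<in>T \<inter> {0..}. \<bar>g t - f t\<bar> < \<epsilon>}"
    using assms(4) by simp
  with assms(1) openin_pointwise_nbhd[OF assms(2)]
  have "\<exists>g. g \<in> A \<and> g \<in> {g \<in> funs_Rplus. \<forall>t\<in>T \<inter> {0..}. \<bar>g t - f t\<bar> < \<epsilon>}"
    unfolding in_closure_of by (elim conjE allE impE) (rule conjI, assumption+)
  with assms(3) show ?thesis by blast
qed

text \<open>Were \<open>?F\<close> finite, it would be closed, the product being Hausdorff. As
  \<open>f\<close> is not in \<open>?F\<close>, it would lie in the closure of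
  \<open>A - ?F\<close>, where no approximant is left.\<close>

lemma pointwise_closure_infinite_approx:
  assumes f: "f \<in> pointwise_topology closure_of A" "f \<notin> A" and A: "A \<subseteq> funs_Rplus"
    and T: "finite T" "T \<subseteq> {0..}" "\<epsilon> > 0"
  shows "infinite {g\<in>A. \<forall>t\<in>T. \<bar>g t - f t\<bar> < \<epsilon>}" (is "infinite ?F")
proof
  assume fin: "finite ?F"
  have "Hausdorff_space pointwise_topology"
    by (simp add: Hausdorff_space_product_topology)
  moreover have "?F \<subseteq> topspace pointwise_topology"
    unfolding topspace_pointwise_topology using A by blast
  ultimately have "closedin pointwise_topology ?F"
    using fin by (rule closedin_Hausdorff_finite)
  then have "pointwise_topology closure_of ?F = ?F"
    by (simp add: closure_of_closedin)
  moreover have "A = (A - ?F) \<union> ?F" by blast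
  ultimately have "f \<in> pointwise_topology closure_of (A - ?F)"
    using f by (metis (no_types, lifting) Un_iff closure_of_Un mem_Collect_eq)
  from pointwise_closure_approx[OF this T] show False by blast
qed

lemma pointwise_closure_le_hump_excess:
  assumes f: "f \<in> pointwise_topology closure_of A" "f \<notin> A" and A: "A \<subseteq> funs_Rplus"
    and st: "s \<in> {0..}" "t \<in> {0..}"
  shows "ennreal \<bar>f s - f t\<bar> \<le> hump_excess A s t"
proof (rule ennreal_le_epsilon)
  fix e :: real assume "e > 0"
  let ?F = "{g\<in>A. \<forall>x\<in>{s,t}. \<bar>g x - f x\<bar> < e/2}"
  have "infinite ?F"
    using f A st \<open>e > 0\<close> by (intro pointwise_closure_infinite_approx) auto
  \<comment> \<open>Countability makes \<open>C\<close> admissible in \<open>hump_excess\<close>;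
    infinitude keeps \<open>C - J\<close> nonempty for every finite \<open>J\<close>.\<close>
  then obtain C where C: "C \<subseteq> ?F" "infinite C" "countable C"
    using infinite_countable_subset'[of ?F] by blast
  have "ennreal \<bar>f s - f t\<bar> \<le> (SUP g \<in> C - J. ennreal \<bar>g s - g t\<bar>) + ennreal e"
    if J: "finite J" for J
  proof -
    obtain g where g: "g \<in> C - J"
      using C(2) J by (metis Diff_infinite_finite ex_in_conv finite.emptyI)
    have "\<bar>g s - f s\<bar> < e/2" "\<bar>g t - f t\<bar> < e/2"
      using g C(1) by auto
    then have "\<bar>f s - f t\<bar> \<le> \<bar>g s - g t\<bar> + e" by linarith
    then have "ennreal \<bar>f s - f t\<bar> \<le> ennreal \<bar>g s - g t\<bar> + ennreal e"
      using \<open>e > 0\<close> by (simp add: ennreal_plus[symmetric] ennreal_leI del: ennreal_plus)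
    also have "ennreal \<bar>g s - g t\<bar> \<le> (SUP g \<in> C - J. ennreal \<bar>g s - g t\<bar>)"
      using g by (rule SUP_upper)
    finally show ?thesis by (simp add: add_right_mono)
  qed
  \<comment> \<open>Truncated subtraction moves \<open>e\<close> to the left, so that the right side
    is exactly the term under the infimum in \<open>rho\<close>.\<close>
  then have "ennreal \<bar>f s - f t\<bar> - ennreal e \<le> rho C s t"
    unfolding rho_def by (intro INF_greatest) (simp add: ennreal_minus_le_iff add.commute)
  also have "rho C s t \<le> hump_excess A s t"
    unfolding hump_excess_def using C by (intro SUP_upper) auto
  finally show "ennreal \<bar>f s - f t\<bar> \<le> hump_excess A s t + ennreal e"
    by (simp add: ennreal_minus_le_iff add.commute)
qed

text \<open>An \<epsilon>/3 argument: the approximant \<open>g\<close> of \<open>f\<close> at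
  \<open>s\<close> and \<open>t\<close> may change with \<open>s\<close>, but \<open>d\<close>
  serves all of \<open>B\<close> at once.\<close>

lemma equicontinuous_at_pointwise_closure:
  assumes B: "equicontinuous_at B t" and f: "f \<in> pointwise_topology closure_of B"
    and t: "t \<in> {0..}"
  shows "(f \<longlongrightarrow> f t) (at t within {0..})"
  unfolding tendsto_iff
proof (intro allI impI)
  fix e :: real assume "e > 0"
  with B obtain d where d: "d > 0"
    "\<And>s g. \<lbrakk>s \<in> {0..}; \<bar>s - t\<bar> < d; g \<in> B\<rbrakk> \<Longrightarrow> \<bar>g s - g t\<bar> < e/3"
    unfolding equicontinuous_at_def by (metis zero_less_divide_iff zero_less_numeral)
  have "dist (f s) (f t) < e" if s: "s \<in> {0..}" "dist s t < d" for s
  proof -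
    obtain g where g: "g \<in> B" "\<forall>x\<in>{s,t}. \<bar>g x - f x\<bar> < e/3"
      using pointwise_closure_approx[OF f, of "{s,t}" "e/3"] s t \<open>e > 0\<close> by auto
    then have "\<bar>g s - f s\<bar> < e/3" "\<bar>g t - f t\<bar> < e/3" "\<bar>g s - g t\<bar> < e/3"
      using d(2)[of s g] s by (auto simp: dist_real_def)
    then show ?thesis unfolding dist_real_def by linarith
  qed
  with \<open>d > 0\<close> show "\<forall>\<^sub>F s in at t within {0..}. dist (f s) (f t) < e"
    unfolding eventually_at by blast
qed

lemma equicontinuous_after_humps_closure:
  assumes H: "H \<subseteq> cont_funs_Rplus" "equicontinuous_after_humps H"
  shows "pointwise_topology closure_of H \<subseteq> cont_funs_Rplus"
proof
  fix f assume f: "f \<in> pointwise_topology closure_of H"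
  have "(f \<longlongrightarrow> f t) (at t within {0..})" if t: "t \<in> {0..}" for t
  \<comment> \<open>Members of \<open>H\<close> are continuous by assumption; they are split off
    because the bound by \<open>hump_excess\<close> is for limits outside
    \<open>H - B\<close>.\<close>
  proof (cases "f \<in> H")
    case True
    with H(1) t show ?thesis by (auto simp: cont_funs_Rplus_def continuous_on_def)
  next
    case False
    from H(2) t obtain B where B: "B \<subseteq> H" "equicontinuous_at B t"
      and lim: "((\<lambda>s. hump_excess (H - B) s t) \<longlongrightarrow> 0) (at t within {0..})"
      unfolding equicontinuous_after_humps_def by blast
    \<comment> \<open>Closure distributes over a finite union, so \<open>f\<close> is a limit of one
      of the two pieces.\<close>
    have "H = B \<union> (H - B)" using B(1) by blast
    with f consider "f \<in> pointwise_topology closure_of B"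
      | "f \<in> pointwise_topology closure_of (H - B)"
      by (metis Un_iff closure_of_Un)
    then show ?thesis
    proof cases
      case 1
      with B(2) t show ?thesis by (intro equicontinuous_at_pointwise_closure)
    next
      case 2
      have "\<forall>\<^sub>F s in at t within {0..}. ennreal \<bar>f s - f t\<bar> \<le> hump_excess (H - B) s t"
        unfolding eventually_at_filter
        using 2 False H(1) t
        by (intro always_eventually) 
          (auto intro!: pointwise_closure_le_hump_excess simp: cont_funs_Rplus_def)
      then have "((\<lambda>s. ennreal \<bar>f s - f t\<bar>) \<longlongrightarrow> ennreal 0) (at t within {0..})"
        using tendsto_sandwich[OF _ _ tendsto_const lim] by simp
      then have "((\<lambda>s. \<bar>f s - f t\<bar>) \<longlongrightarrow> 0) (at t within {0..})"
        by (subst (asm) tendsto_ennreal_iff) auto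
      then show ?thesis
        by (simp add: LIM_zero_iff tendsto_rabs_zero_iff)
    qed
  qed
  with f show "f \<in> cont_funs_Rplus"
    by (auto simp: cont_funs_Rplus_def continuous_on_def in_closure_of funs_Rplus_def)
qed

text \<open>The closures of the sets \<open>H(t)\<close> are compact, so by Tychonoff their product
  is. It is also closed and contains \<open>H\<close>, hence contains the closure of
  \<open>H\<close>.\<close>

lemma compactin_pointwise_closure:
  assumes H: "H \<subseteq> funs_Rplus"
    and rc: "\<And>t. t \<in> {0..} \<Longrightarrow> relatively_compactin euclidean ((\<lambda>f. f t) ` H)"
  shows "compactin pointwise_topology (pointwise_topology closure_of H)"
proof (rule closed_compactin)
  let ?P = "PiE {0..} (\<lambda>t. closure ((\<lambda>f. f t) ` H))"
  show "compactin pointwise_topology ?P"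
    using rc by (auto simp: compactin_PiE relatively_compactin_def)
  have "closedin pointwise_topology ?P"
    by (auto simp: closedin_product_topology)
  moreover have "H \<subseteq> ?P"
    using H by (auto simp: funs_Rplus_def PiE_def Pi_def intro: closure_subset[THEN subsetD])
  ultimately show "pointwise_topology closure_of H \<subseteq> ?P"
    by (intro closure_of_minimal)
qed simp

text \<open>Membership in \<open>sticking_nbhd e {t} f\<close> controls the value at
  \<open>t\<close> itself, so every evaluation map is continuous. Pointwise closed sets are
  therefore sticking closed.\<close>

lemma continuous_map_sticking_pointwise:
  "continuous_map sticking_topology pointwise_topology (\<lambda>g. g)"
proof -
  have "openin sticking_topology {f \<in> funs_Rplus. f t \<in> U}" if "t \<in> {0..}" "open U" for t U
    unfolding openin_sticking_topology sticking_open_def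
  proof (intro conjI ballI)
    fix f assume f: "f \<in> {f \<in> funs_Rplus. f t \<in> U}"
    with \<open>open U\<close> obtain e where e: "e > 0" "ball (f t) e \<subseteq> U"
      using openE by blast
    have "sticking_nbhd e {t} f \<subseteq> {f \<in> funs_Rplus. f t \<in> U}"
      using e \<open>t \<in> {0..}\<close> by (force simp: sticking_nbhd_def dist_real_def)
    with e(1) \<open>t \<in> {0..}\<close>
    show "\<exists>\<epsilon>>0. \<exists>T. finite T \<and> T \<noteq> {} \<and> T \<subseteq> {0..} \<and>
        sticking_nbhd \<epsilon> T f \<subseteq> {f \<in> funs_Rplus. f t \<in> U}"
      by (intro exI[of _ e] conjI exI[of _ "{t}"]) auto
  qed auto
  then show ?thesis
    unfolding continuous_map_componentwise
    by (auto simp: continuous_map_def topspace_sticking_topology funs_Rplus_def PiE_def)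
qed

text \<open>For continuous \<open>f\<close> and \<open>g\<close>, a strict bound on
  \<open>\<bar>f - g\<bar>\<close> at the finitely many points of \<open>T\<close> persists on
  intervals around them. This carries compactness from the pointwise to the sticking
  topology.\<close>

lemma continuous_map_pointwise_sticking:
  assumes K: "K \<subseteq> cont_funs_Rplus"
  shows "continuous_map (subtopology pointwise_topology K) sticking_topology (\<lambda>g. g)"
  unfolding continuous_map
proof (intro conjI allI impI)
  show "(\<lambda>g. g) ` topspace (subtopology pointwise_topology K) \<subseteq> topspace sticking_topology"
    by (auto simp: topspace_sticking_topology funs_Rplus_def)
  fix U assume "openin sticking_topology U"
  then have U: "sticking_open U" by (simp add: openin_sticking_topology)
  let ?V = "{g \<in> topspace (subtopology pointwise_topology K). g \<in> U}"
  show "openin (subtopology pointwise_topology K) ?V"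
  proof (subst openin_subopen, intro ballI)
    fix f assume f: "f \<in> ?V"
    then have fK: "f \<in> K" "f \<in> funs_Rplus" by (auto simp: funs_Rplus_def)
    from f U obtain e T where e: "e > 0" and T: "finite T" "T \<subseteq> {0..}"
      and sub: "sticking_nbhd e T f \<subseteq> U"
      unfolding sticking_open_def by blast
    let ?N = "{g \<in> funs_Rplus. \<forall>t\<in>T \<inter> {0..}. \<bar>g t - f t\<bar> < e}"
    have "g \<in> sticking_nbhd e T f" if g: "g \<in> K" "g \<in> ?N" for g
    proof -
      have "\<exists>d>0. \<forall>s\<in>{0..}. dist s t < d \<longrightarrow> \<bar>f s - g s\<bar> < e" if t: "t \<in> T" for t
      proof -
        have "continuous_on {0..} (\<lambda>s. \<bar>f s - g s\<bar>)"
          using g(1) fK(1) K by (intro continuous_intros) (auto simp: cont_funs_Rplus_def)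
        moreover have "t \<in> {0..}" using t T(2) by blast
        ultimately have "((\<lambda>s. \<bar>f s - g s\<bar>) \<longlongrightarrow> \<bar>f t - g t\<bar>) (at t within {0..})"
          by (simp add: continuous_on_def)
        moreover have lt: "\<bar>f t - g t\<bar> < e"
          using g(2) t \<open>t \<in> {0..}\<close> by (auto simp: abs_minus_commute)
        ultimately have "\<forall>\<^sub>F s in at t within {0..}. \<bar>f s - g s\<bar> < e"
          by (rule order_tendstoD)
        then obtain d where "d > 0"
          "\<And>s. \<lbrakk>s \<in> {0..}; s \<noteq> t; dist s t < d\<rbrakk> \<Longrightarrow> \<bar>f s - g s\<bar> < e"
          unfolding eventually_at by blast
        \<comment> \<open>The punctured filter says nothing about \<open>s = t\<close>;
          \<open>lt\<close> covers that point.\<close>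
        with lt show ?thesis by (intro exI[of _ d]) auto
      qed
      then obtain d where d: "\<And>t. t \<in> T \<Longrightarrow> d t > 0"
        "\<And>t s. \<lbrakk>t \<in> T; s \<in> {0..}; dist s t < d t\<rbrakk> \<Longrightarrow> \<bar>f s - g s\<bar> < e"
        by metis
      \<comment> \<open>One radius for all of \<open>T\<close>; the inserted \<open>1\<close> keeps
        \<open>Min\<close> defined when \<open>T\<close> is empty.\<close>
      define \<eta> where "\<eta> = Min (insert 1 (d ` T))"
      have "\<eta> > 0" "\<And>t. t \<in> T \<Longrightarrow> \<eta> \<le> d t"
        using T(1) d(1) by (auto simp: \<eta>_def)
      moreover from this(2) have "\<bar>f s - g s\<bar> < e" if "s \<in> {0..}" "t \<in> T" "s \<in> {t - \<eta><..<t + \<eta>}" for s t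
        using d(2)[of t s] that by (force simp: dist_real_def)
      ultimately show ?thesis
        using g(2) unfolding sticking_nbhd_def by blast
    qed
    with sub have "?N \<inter> K \<subseteq> ?V" by (auto simp: funs_Rplus_def)
    moreover have "openin (subtopology pointwise_topology K) (?N \<inter> K)"
      using openin_pointwise_nbhd[OF T(1)] by (rule openin_subtopology_Int)
    moreover have "f \<in> ?N \<inter> K" using fK e by simp
    ultimately show "\<exists>W. openin (subtopology pointwise_topology K) W \<and> f \<in> W \<and> W \<subseteq> ?V"
      by blast
  qed
qed

theorem proposition13:
  fixes H :: "(real \<Rightarrow> real) set"
  assumes "H \<subseteq> cont_funs_Rplus"
    and "equicontinuous_after_humps H"
    and "\<And>t. t \<in> {0..} \<Longrightarrow> relatively_compactin euclidean ((\<lambda>f. f t) ` H)"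
  shows "relatively_compactin sticking_topology H"
proof -
  let ?K = "pointwise_topology closure_of H"
  have H: "H \<subseteq> funs_Rplus" using assms(1) by (auto simp: cont_funs_Rplus_def)
  have K: "?K \<subseteq> funs_Rplus"
    using closure_of_subset_topspace unfolding topspace_pointwise_topology[symmetric] .
  have "compactin (subtopology pointwise_topology ?K) ?K"
    using compactin_pointwise_closure[OF H assms(3)] by (simp add: compactin_subtopology)
  then have comp: "compactin sticking_topology ?K"
    using image_compactin[OF _ continuous_map_pointwise_sticking[OF
          equicontinuous_after_humps_closure[OF assms(1,2)]]]
    by simp
  \<comment> \<open>\<open>?K\<close> is its own preimage under the identity, so it is a sticking
    closed set containing \<open>H\<close>, and the sticking closure of \<open>H\<close> is a closed
    part of the compact \<open>?K\<close>.\<close>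
  have "closedin sticking_topology {g \<in> topspace sticking_topology. g \<in> ?K}"
    by (rule closedin_continuous_map_preimage[OF continuous_map_sticking_pointwise]) simp
  moreover have "{g \<in> topspace sticking_topology. g \<in> ?K} = ?K"
    using K by (auto simp: topspace_sticking_topology)
  moreover have "H \<subseteq> ?K"
    using H by (intro closure_of_subset) (simp add: funs_Rplus_def)
  ultimately have "sticking_topology closure_of H \<subseteq> ?K"
    by (intro closure_of_minimal) auto
  then have "compactin sticking_topology (sticking_topology closure_of H)"
    by (rule closed_compactin[OF comp]) simp
  with H show ?thesis
    by (simp add: relatively_compactin_def topspace_sticking_topology)
qed

end
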